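(* Let $D=\{(b_i,d_i)\}_{i=1}^N$ and $D'=\{(b_i',d_i')\}_{i=1}^N$ be persistence diagrams indexed by the same set $\{1,\dots,N\}$ via a fixed bottleneck-distance-optimal matching between them (after padding with diagonal points), so that $\max_{i}\max(|b_i-b_i'|,|d_i-d_i'|)=d_B(D,D')=:\delta$. Let $K\ge1$ be an integer, $M\subset\mathbb{R}$ a finite set, and let $f:\mathbb{R}^{K\times|M|}\to\mathbb{R}$ be $L_f$-Lipschitz with respect to the $1$-norm, i.e. $|f(x)-f(y)|\le L_f\|x-y\|_1$. Let $\varphi_i(v_f;D)$ and $\varphi_i(v_f;D')$ be the Shapley values of player $i$ in the games $v_f$ constructed from $D$ and $D'$, respectively. Then for every player $i\in\{1,\dots,N\}$, \[|\varphi_i(v_f;D)-\varphi_i(v_f;D')|\le 2L_fK|M|\delta.\]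
   Context: A persistence diagram is a finite indexed family of points $(b_i,d_i)\in\mathbb{R}^2$ with $b_i\le d_i$. Diagonal points $(x,x)$ are allowed (they are used to pad the diagrams to equal size $N$). A matching between diagrams $D,D'$ is a bijection $\gamma:D\cup\Delta\to D'\cup\Delta$, where $\Delta=\{(x,x):x\in\mathbb{R}\}$ is taken with infinite multiplicity, and $d_B(D,D')=\inf_\gamma\sup_p\|p-\gamma(p)\|_\infty$. Point $i$ of $D$ and point $i$ of $D'$ are the two ends of one matched pair of the fixed optimal matching. The tent function of a point $(b_i,d_i)$ is $\ell_i(m)=\min(\max(0,m-b_i),\max(0,d_i-m))$. For a diagram with points indexed by $\{1,\dots,N\}$ and a coalition $S\subset\{1,\dots,N\}$, $\Lambda(S)\in\mathbb{R}^{K\times|M|}$ is the discretized persistence landscape of the points in $S$: $\Lambda(S)_{(k,m)}$ is the $k$-th largest value (with multiplicity) among $\{\ell_i(m):i\in S\}$ if $|S|\ge k$, and $0$ if $|S|<k$, for $k\in\{1,\dots,K\}$, $m\in M$. The game of $f$ on that diagram is $v_f(S)=f(\Lambda(S))$. The Shapley value of player $i$ for a set function $v:2^{\{1,\dots,N\}}\to\mathbb{R}$ is $\varphi_i(v)=\frac1N\sum_{S\subset\{1,\dots,N\}\setminus\{i\}}\binom{N-1}{|S|}^{-1}(v(S\cup\{i\})-v(S))$. *)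

theory Defs
  imports Complex_Main "HOL-Library.Multiset" "HOL-Library.FuncSet"
    "HOL-Library.Extended_Real"
begin

definition persistence_diagram :: "'i set \<Rightarrow> ('i \<Rightarrow> real \<times> real) \<Rightarrow> bool" where
  "persistence_diagram I D \<longleftrightarrow> finite I \<and> (\<forall>i\<in>I. fst (D i) \<le> snd (D i))"

text \<open>The metric of the sup norm on the plane; the library norm on pairs is the Euclidean one.\<close>

definition linf_dist :: "real \<times> real \<Rightarrow> real \<times> real \<Rightarrow> real" where
  "linf_dist p q = max \<bar>fst p - fst q\<bar> \<bar>snd p - snd q\<bar>"

text \<open>Points of a diagram together with the diagonal are encoded by \<open>I <+> UNIV\<close>:
  \<open>Inl i\<close> is the point with index \<open>i\<close>, and \<open>Inr (x, n)\<close> is the \<open>n\<close>-th copy of the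
  diagonal point \<open>(x, x)\<close>, so that each diagonal point has infinite multiplicity.\<close>

fun diagram_point :: "('i \<Rightarrow> real \<times> real) \<Rightarrow> 'i + real \<times> nat \<Rightarrow> real \<times> real" where
  "diagram_point D (Inl i) = D i"
| "diagram_point D (Inr (x, n)) = (x, x)"

definition diagram_matching ::
    "'i set \<Rightarrow> 'j set \<Rightarrow> ('i + real \<times> nat \<Rightarrow> 'j + real \<times> nat) \<Rightarrow> bool" where
  "diagram_matching I J \<gamma> \<longleftrightarrow> bij_betw \<gamma> (I <+> UNIV) (J <+> UNIV)"

text \<open>The cost is extended-real valued because a matching may move diagonal points
  arbitrarily far.\<close>

definition matching_cost ::
    "'i set \<Rightarrow> ('i \<Rightarrow> real \<times> real) \<Rightarrow> ('j \<Rightarrow> real \<times> real)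
      \<Rightarrow> ('i + real \<times> nat \<Rightarrow> 'j + real \<times> nat) \<Rightarrow> ereal" where
  "matching_cost I D E \<gamma> =
    (SUP p \<in> I <+> UNIV. ereal (linf_dist (diagram_point D p) (diagram_point E (\<gamma> p))))"

definition bottleneck_distance ::
    "'i set \<Rightarrow> ('i \<Rightarrow> real \<times> real) \<Rightarrow> 'j set \<Rightarrow> ('j \<Rightarrow> real \<times> real) \<Rightarrow> ereal" where
  "bottleneck_distance I D J E = (INF \<gamma> \<in> Collect (diagram_matching I J). matching_cost I D E \<gamma>)"

definition bottleneck_optimal_matching ::
    "'i set \<Rightarrow> ('i \<Rightarrow> real \<times> real) \<Rightarrow> 'j set \<Rightarrow> ('j \<Rightarrow> real \<times> real)
      \<Rightarrow> ('i + real \<times> nat \<Rightarrow> 'j + real \<times> nat) \<Rightarrow> bool" where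
  "bottleneck_optimal_matching I D J E \<gamma> \<longleftrightarrow>
    diagram_matching I J \<gamma> \<and> matching_cost I D E \<gamma> = bottleneck_distance I D J E"

definition tent :: "real \<times> real \<Rightarrow> real \<Rightarrow> real" where
  "tent p m = min (max 0 (m - fst p)) (max 0 (snd p - m))"

text \<open>The \<open>k\<close>-th largest element (with multiplicity, counting from \<open>k = 1\<close>) of the family
  \<open>g\<close> on the finite set \<open>S\<close>, and \<open>0\<close> if there are fewer than \<open>k\<close> elements.\<close>

definition kth_largest :: "nat \<Rightarrow> ('i \<Rightarrow> real) \<Rightarrow> 'i set \<Rightarrow> real" where
  "kth_largest k g S =
    (if k \<le> card S
     then rev (sorted_list_of_multiset (image_mset g (mset_set S))) ! (k - 1) else 0)"

text \<open>Real arrays with index set \<open>{1..K} \<times> M\<close> are functions on pairs that are \<open>undefined\<close>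
  outside of that index set.\<close>

definition arrays :: "nat \<Rightarrow> real set \<Rightarrow> (nat \<times> real \<Rightarrow> real) set" where
  "arrays K M = {1..K} \<times> M \<rightarrow>\<^sub>E UNIV"

definition landscape ::
    "nat \<Rightarrow> real set \<Rightarrow> ('i \<Rightarrow> real \<times> real) \<Rightarrow> 'i set \<Rightarrow> nat \<times> real \<Rightarrow> real" where
  "landscape K M D S =
    (\<lambda>(k, m) \<in> {1..K} \<times> M. kth_largest k (\<lambda>i. tent (D i) m) S)"

definition lipschitz_one_norm ::
    "nat \<Rightarrow> real set \<Rightarrow> real \<Rightarrow> ((nat \<times> real \<Rightarrow> real) \<Rightarrow> real) \<Rightarrow> bool" where
  "lipschitz_one_norm K M L f \<longleftrightarrow>
    (\<forall>x \<in> arrays K M. \<forall>y \<in> arrays K M.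
      \<bar>f x - f y\<bar> \<le> L * (\<Sum>p \<in> {1..K} \<times> M. \<bar>x p - y p\<bar>))"

definition landscape_game ::
    "nat \<Rightarrow> real set \<Rightarrow> ((nat \<times> real \<Rightarrow> real) \<Rightarrow> real) \<Rightarrow> ('i \<Rightarrow> real \<times> real) \<Rightarrow> 'i set \<Rightarrow> real" where
  "landscape_game K M f D S = f (landscape K M D S)"

definition shapley_value :: "nat \<Rightarrow> (nat set \<Rightarrow> real) \<Rightarrow> nat \<Rightarrow> real" where
  "shapley_value N v i =
    (1 / real N) * (\<Sum>S \<in> Pow ({1..N} - {i}).
      inverse (real ((N - 1) choose card S)) * (v (S \<union> {i}) - v S))"

end

theory Submission
  imports Defs
begin

text \<open>The value of the \<open>k\<close>-th largest element is at least \<open>t\<close> iff at least \<open>k\<close> members of the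
  family are at least \<open>t\<close>; hence it is 1-Lipschitz in the sup norm, and so is each entry of the
  landscape. Therefore the two games differ by at most \<open>L K |M| \<delta>\<close> on every coalition, so the
  marginal contributions differ by at most twice that, and the Shapley value is a weighted average
  of marginal contributions.\<close>

text \<open>In a descending list the entries that are at least \<open>t\<close> form a prefix, so
  the length of that prefix decides which positions lie in it.\<close>

lemma le_nth_iff_length_filter:
  fixes t :: "'a::linorder"
  assumes "sorted_wrt (\<ge>) xs" and "k < length xs"
  shows "t \<le> xs ! k \<longleftrightarrow> k < length (filter ((\<le>) t) xs)"
  using assms
proof (induction xs arbitrary: k)
  case Nil
  then show ?case by simp
next
  case (Cons y ys)
  show ?case
  proof (cases "t \<le> y")
    case True
    with Cons show ?thesis by (cases k) auto
  next
    case False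
    then have below: "\<not> t \<le> x" if "x \<in> set (y # ys)" for x
      using Cons.prems(1) that by auto
    then have "filter ((\<le>) t) (y # ys) = []"
      by (auto simp: filter_empty_conv)
    then show ?thesis
      using below[OF nth_mem[OF Cons.prems(2)]] by simp
  qed
qed

text \<open>Turns an order statistic into a cardinality of indices. The image multiset keeps one
  copy per index, so ties are counted correctly.\<close>

lemma le_kth_largest_iff:
  assumes "finite S" and "1 \<le> k" and "k \<le> card S"
  shows "t \<le> kth_largest k g S \<longleftrightarrow> k \<le> card {i \<in> S. t \<le> g i}"
proof -
  let ?X = "image_mset g (mset_set S)"
  let ?xs = "rev (sorted_list_of_multiset ?X)"
  have mset_xs: "mset ?xs = ?X" by simp
  have "length ?xs = size (mset ?xs)" by (rule size_mset[symmetric])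
  also have "\<dots> = card S" by (simp only: mset_xs size_image_mset size_mset_set)
  finally have len: "length ?xs = card S" .
  have "length (filter ((\<le>) t) ?xs) = size (filter_mset ((\<le>) t) (mset ?xs))"
    by (simp only: mset_filter[symmetric] size_mset)
  also have "\<dots> = card {i \<in> S. t \<le> g i}"
    using assms(1) by (simp only: mset_xs filter_mset_image_mset size_image_mset
        filter_mset_mset_set size_mset_set)
  finally have "length (filter ((\<le>) t) ?xs) = card {i \<in> S. t \<le> g i}" .
  moreover have "sorted_wrt (\<ge>) ?xs"
    by (simp add: sorted_wrt_rev)
  \<comment> \<open>Lists are indexed from 0: \<open>k - 1 < c\<close> means
    \<open>k \<le> c\<close> because \<open>1 \<le> k\<close>.\<close>
  ultimately have "t \<le> ?xs ! (k - 1) \<longleftrightarrow> k - 1 < card {i \<in> S. t \<le> g i}"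
    using le_nth_iff_length_filter[of ?xs "k - 1" t] assms len by simp
  then show ?thesis
    using assms by (auto simp: kth_largest_def)
qed

lemma kth_largest_diff_le:
  assumes "finite S" and "1 \<le> k" and "0 \<le> \<delta>"
    and close: "\<And>i. i \<in> S \<Longrightarrow> \<bar>g i - h i\<bar> \<le> \<delta>"
  shows "\<bar>kth_largest k g S - kth_largest k h S\<bar> \<le> \<delta>"
proof (cases "k \<le> card S")
  case True
  have shift: "kth_largest k u S - \<delta> \<le> kth_largest k v S"
    if uv: "\<And>i. i \<in> S \<Longrightarrow> u i - \<delta> \<le> v i" for u v :: "'a \<Rightarrow> real"
  proof -
    \<comment> \<open>The threshold is the order statistic of \<open>u\<close> itself. The k or more
      indices that reach it under \<open>u\<close> still reach \<open>?t - \<delta>\<close> under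
      \<open>v\<close>.\<close>
    let ?t = "kth_largest k u S"
    have "k \<le> card {i \<in> S. ?t \<le> u i}"
      using le_kth_largest_iff[OF assms(1,2) True] by blast
    also have "\<dots> \<le> card {i \<in> S. ?t - \<delta> \<le> v i}"
      using assms(1) uv by (intro card_mono) force+
    finally show ?thesis
      using le_kth_largest_iff[OF assms(1,2) True] by blast
  qed
  have "kth_largest k g S - \<delta> \<le> kth_largest k h S"
    by (rule shift) (use close in force)
  moreover have "kth_largest k h S - \<delta> \<le> kth_largest k g S"
    by (rule shift) (use close in force)
  ultimately show ?thesis by linarith
\<comment> \<open>With fewer than \<open>k\<close> members both values are the default 0, and
  \<open>0 \<le> \<delta>\<close> closes the case.\<close>
qed (use assms in \<open>simp add: kth_largest_def\<close>)

text \<open>Truncation at 0 and binary minimum are nonexpansive in the sup norm.\<close>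

lemma tent_diff_le: "\<bar>tent p m - tent q m\<bar> \<le> linf_dist p q"
  unfolding tent_def linf_dist_def by linarith

lemma landscape_game_diff_le:
  assumes lip: "lipschitz_one_norm K M L f" and "finite M" and "finite S" and "0 \<le> \<delta>"
    and close: "\<And>j. j \<in> S \<Longrightarrow> linf_dist (D j) (E j) \<le> \<delta>"
  shows "\<bar>landscape_game K M f D S - landscape_game K M f E S\<bar> \<le> L * real K * real (card M) * \<delta>"
proof -
  let ?I = "{1..K} \<times> M"
  let ?d = "\<lambda>p. \<bar>landscape K M D S p - landscape K M E S p\<bar>"
  have arr: "landscape K M C S \<in> arrays K M" for C
    unfolding landscape_def arrays_def by auto
  have lip_le: "\<bar>f x - f y\<bar> \<le> L * (\<Sum>p\<in>?I. \<bar>x p - y p\<bar>)"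
    if "x \<in> arrays K M" "y \<in> arrays K M" for x y
    using lip that unfolding lipschitz_one_norm_def by blast
  have entry: "?d p \<le> \<delta>" if p: "p \<in> ?I" for p
  proof -
    obtain k m where km: "p = (k, m)" "1 \<le> k" using p by auto
    have "\<bar>tent (D j) m - tent (E j) m\<bar> \<le> \<delta>" if "j \<in> S" for j
      using tent_diff_le close[OF that] by (rule order_trans)
    then show ?thesis
      using kth_largest_diff_le[OF assms(3) km(2) assms(4)] p km(1)
      by (simp add: landscape_def)
  qed
  have "\<bar>landscape_game K M f D S - landscape_game K M f E S\<bar> \<le> L * (\<Sum>p\<in>?I. ?d p)"
    unfolding landscape_game_def by (rule lip_le) (rule arr)+
  also have "\<dots> \<le> L * (real (card ?I) * \<delta>)"
  proof (cases "?I = {}")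
    case False
    \<comment> \<open>Monotonicity in the sum requires \<open>0 \<le> L\<close>. The constant arrays
      1 and 0 lie at 1-norm distance \<open>card ?I > 0\<close>, so the Lipschitz bound between them
      forces this sign.\<close>
    let ?a = "\<lambda>c. \<lambda>p\<in>?I. c :: real"
    have "0 \<le> \<bar>f (?a 1) - f (?a 0)\<bar>" by simp
    also have "\<dots> \<le> L * (\<Sum>p\<in>?I. \<bar>?a 1 p - ?a 0 p\<bar>)"
      by (rule lip_le) (auto simp: arrays_def)
    also have "(\<Sum>p\<in>?I. \<bar>?a 1 p - ?a 0 p\<bar>) = real (card ?I)" by simp
    finally have "0 * real (card ?I) \<le> L * real (card ?I)" by simp
    moreover have "0 < real (card ?I)"
      using False \<open>finite M\<close> by (simp add: card_gt_0_iff del: card_cartesian_product)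
    ultimately have "0 \<le> L" by (rule mult_right_le_imp_le)
    moreover have "(\<Sum>p\<in>?I. ?d p) \<le> real (card ?I) * \<delta>"
      by (rule sum_bounded_above) (rule entry)
    ultimately show ?thesis by (rule mult_left_mono[rotated])
  next
    \<comment> \<open>Over an empty index set both sides are 0, whatever the sign of
      \<open>L\<close>.\<close>
    case True
    show ?thesis unfolding True by simp
  qed
  finally show ?thesis by (simp add: card_cartesian_product mult.assoc)
qed

text \<open>Normalization of the Shapley weights: the subsets of each size n have total weight 1,
  and n ranges over 0 to \<open>card A\<close>.\<close>

lemma sum_inverse_choose_card_Pow:
  assumes "finite A"
  shows "(\<Sum>S\<in>Pow A. inverse (real (card A choose card S))) = real (card A) + 1"
proof -
  have "(\<Sum>S\<in>Pow A. inverse (real (card A choose card S)))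
      = (\<Sum>n\<le>card A. \<Sum>S\<in>{S \<in> Pow A. card S = n}. inverse (real (card A choose card S)))"
    using assms by (intro sum.group[symmetric]) (auto intro: card_mono)
  also have "\<dots> = (\<Sum>n\<le>card A. 1)"
  proof (rule sum.cong)
    fix n assume "n \<in> {..card A}"
    then show "(\<Sum>S\<in>{S \<in> Pow A. card S = n}. inverse (real (card A choose card S))) = 1"
      using n_subsets[OF assms, of n] by simp
  qed simp
  finally show ?thesis by simp
qed

lemma shapley_value_diff_le:
  assumes i: "i \<in> {1..N}"
    and close: "\<And>S. S \<subseteq> {1..N} \<Longrightarrow> \<bar>v S - w S\<bar> \<le> B"
  shows "\<bar>shapley_value N v i - shapley_value N w i\<bar> \<le> 2 * B"
proof -
  let ?A = "{1..N} - {i}"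
  let ?c = "\<lambda>S. inverse (real (N - 1 choose card S))"
  let ?\<Delta> = "\<lambda>u S. u (S \<union> {i}) - u S"
  have card_A: "card ?A = N - 1" using i by simp
  have "\<bar>\<Sum>S\<in>Pow ?A. ?c S * (?\<Delta> v S - ?\<Delta> w S)\<bar> \<le> (\<Sum>S\<in>Pow ?A. ?c S * (2 * B))"
  proof (rule order_trans[OF sum_abs sum_mono])
    fix S assume "S \<in> Pow ?A"
    then have "S \<subseteq> {1..N}" "S \<union> {i} \<subseteq> {1..N}" using i by auto
    \<comment> \<open>The factor 2: a marginal contribution evaluates the game at two coalitions,
      each with error at most \<open>B\<close>.\<close>
    then have "\<bar>?\<Delta> v S - ?\<Delta> w S\<bar> \<le> 2 * B"
      using close[of S] close[of "S \<union> {i}"] by linarith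
    then show "\<bar>?c S * (?\<Delta> v S - ?\<Delta> w S)\<bar> \<le> ?c S * (2 * B)"
      by (simp add: abs_mult mult_left_mono)
  qed
  \<comment> \<open>Since \<open>?A\<close> has \<open>N - 1\<close> elements, the weights sum to
    \<open>N\<close>, which cancels the prefactor \<open>1 / N\<close>.\<close>
  also have "\<dots> = real N * (2 * B)"
    using sum_inverse_choose_card_Pow[of ?A] i
    by (simp add: card_A sum_distrib_right[symmetric] of_nat_diff)
  finally have "\<bar>\<Sum>S\<in>Pow ?A. ?c S * (?\<Delta> v S - ?\<Delta> w S)\<bar> \<le> real N * (2 * B)" .
  moreover have "shapley_value N v i - shapley_value N w i
      = (\<Sum>S\<in>Pow ?A. ?c S * (?\<Delta> v S - ?\<Delta> w S)) / real N"
    unfolding shapley_value_def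
    by (simp add: right_diff_distrib sum_subtractf diff_divide_distrib)
  moreover have "0 < real N" using i by simp
  ultimately show ?thesis
    by (simp only: abs_divide abs_of_nat pos_divide_le_eq mult.commute)
qed

theorem theorem5p2:
  fixes N K :: nat
    and D D' :: "nat \<Rightarrow> real \<times> real"
    and \<gamma> :: "nat + real \<times> nat \<Rightarrow> nat + real \<times> nat"
    and \<delta> L :: real
    and M :: "real set"
    and f :: "(nat \<times> real \<Rightarrow> real) \<Rightarrow> real"
    and i :: nat
  assumes "persistence_diagram {1..N} D"
    and "persistence_diagram {1..N} D'"
    and "bottleneck_optimal_matching {1..N} D {1..N} D' \<gamma>"
    and "\<And>j. j \<in> {1..N} \<Longrightarrow> \<gamma> (Inl j) = Inl j"
    and "\<delta> = Max ((\<lambda>j. max \<bar>fst (D j) - fst (D' j)\<bar> \<bar>snd (D j) - snd (D' j)\<bar>) ` {1..N})"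
    and "ereal \<delta> = bottleneck_distance {1..N} D {1..N} D'"
    and "K \<ge> 1"
    and "finite M"
    and "lipschitz_one_norm K M L f"
    and "i \<in> {1..N}"
  shows "\<bar>shapley_value N (landscape_game K M f D) i - shapley_value N (landscape_game K M f D') i\<bar>
    \<le> 2 * L * real K * real (card M) * \<delta>"
proof -
  have close: "linf_dist (D j) (D' j) \<le> \<delta>" if "j \<in> {1..N}" for j
    unfolding linf_dist_def assms(5) using that by (intro Max_ge) auto
  \<comment> \<open>Player \<open>i\<close> witnesses that the index set is nonempty, so
    \<open>\<delta>\<close> dominates an actual distance.\<close>
  have "0 \<le> linf_dist (D i) (D' i)"
    unfolding linf_dist_def by simp
  also have "\<dots> \<le> \<delta>"
    by (rule close) fact
  finally have nonneg: "0 \<le> \<delta>" .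
  have "\<bar>landscape_game K M f D S - landscape_game K M f D' S\<bar> \<le> L * real K * real (card M) * \<delta>"
    if S: "S \<subseteq> {1..N}" for S
    using assms(9,8) finite_subset[OF S finite_atLeastAtMost] nonneg
  proof (rule landscape_game_diff_le)
    show "linf_dist (D j) (D' j) \<le> \<delta>" if "j \<in> S" for j
      using that S by (blast intro: close)
  qed
  from shapley_value_diff_le[OF assms(10) this] show ?thesis
    by (simp add: mult.assoc)
qed

end
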